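(* Fix integers $n \geq 2$ and $a > 0$. Then $$k(a,a-1,n-1,n-a-1,n-a)_n = (n-a,n-a-1,n-1,a-1,a)_n$$ is a $5$-digit solution for $n$ (for some integer $k$) if and only if $a \mid (n-a)$.
   Context: For integers $n \geq 2$, $h \geq 1$ and $a_0,\dots,a_h$, write $(a_h,a_{h-1},\dots,a_1,a_0)_n = a_h n^h + a_{h-1}n^{h-1} + \cdots + a_1 n + a_0$. Given an integer $k$, one says that $k(a_h,a_{h-1},\dots,a_1,a_0)_n = (a_0,a_1,\dots,a_{h-1},a_h)_n$ is an $(h+1)$-digit solution for $n$ if this equality of integers holds, with $1<k<n$, $0 \leq a_i \leq n-1$ for all $i$, $a_0 \neq 0$, and $a_h \neq 0$.
   Formalization: The cases n = a and n = 2a are excluded, because there a divides n − a but no solution exists: for n = a the last digit n − a is 0, and for n = 2a the equation forces k = 1, contrary to 1 < k. *)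

theory Defs
  imports Main
begin

text \<open>Digit lists are written most significant digit first, so the list
  \<open>[a_h, \<dots>, a_1, a_0]\<close> stands for $(a_h,\dots,a_1,a_0)_n$. The entries are arbitrary
  integers.\<close>

definition base_value :: "int \<Rightarrow> int list \<Rightarrow> int" where
  "base_value n ds = (\<Sum>i<length ds. rev ds ! i * n ^ i)"

text \<open>The first argument is the number of digits $h + 1$; \<open>2 \<le> m\<close> is the condition $h \geq 1$.\<close>

definition digit_solution :: "nat \<Rightarrow> int \<Rightarrow> int \<Rightarrow> int list \<Rightarrow> bool" where
  "digit_solution m n k ds \<longleftrightarrow>
     2 \<le> m \<and> length ds = m \<and> 2 \<le> n \<and>
     1 < k \<and> k < n \<and>
     (\<forall>d \<in> set ds. 0 \<le> d \<and> d \<le> n - 1) \<and>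
     last ds \<noteq> 0 \<and> hd ds \<noteq> 0 \<and>
     k * base_value n ds = base_value n (rev ds)"

end

theory Submission imports Defs begin

text \<open>Carrying out the borrows hidden in the digits \<open>a - 1\<close>, \<open>n - 1\<close>, \<open>n - a - 1\<close>, \<open>n - a\<close>
  shows that the number is a product, \<open>a (n + 1) (n\<^sup>3 - 1)\<close> (lemma \<open>base_value_family\<close>). Reversing
  the digits exchanges \<open>a\<close> and \<open>n - a\<close>, so the reversal is \<open>(n - a) (n + 1) (n\<^sup>3 - 1)\<close>. The common
  factor is positive, and the digit equation collapses to \<open>k a = n - a\<close>. Hence a solution forces
  \<open>a dvd n - a\<close>. Conversely, if \<open>a\<close> divides \<open>n - a\<close> then it divides \<open>n\<close>, so \<open>a < n\<close> because \<open>n \<noteq> a\<close>, and all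
  digits are in range; the quotient \<open>k = (n - a) / a\<close> is less than \<open>n\<close>, and it exceeds \<open>1\<close> because
  \<open>n \<noteq> 2 a\<close>.\<close>

lemma base_value_family:
  "base_value n [a, a - 1, n - 1, n - a - 1, n - a] = a * ((n + 1) * (n ^ 3 - 1))"
  by (simp add: base_value_def lessThan_Suc eval_nat_numeral algebra_simps)

text \<open>Replacing \<open>a\<close> by \<open>n - a\<close> in the digit list reverses it, so no second expansion is
  necessary.\<close>

lemma base_value_rev_family:
  "base_value n (rev [a, a - 1, n - 1, n - a - 1, n - a]) = (n - a) * ((n + 1) * (n ^ 3 - 1))"
  using base_value_family[of n "n - a"] by simp

lemma digit_equation_family_iff:
  fixes n a k :: int
  assumes "n \<ge> 2"
  defines "ds \<equiv> [a, a - 1, n - 1, n - a - 1, n - a]"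
  shows "k * base_value n ds = base_value n (rev ds) \<longleftrightarrow> k * a = n - a"
proof -
  have "n ^ 3 > 1"
    using assms(1) by (intro one_less_power) auto
  then have "n + 1 \<noteq> 0" "n ^ 3 - 1 \<noteq> 0"
    using assms(1) by linarith+
  then have "(n + 1) * (n ^ 3 - 1) \<noteq> 0"
    by (simp only: mult_eq_0_iff simp_thms)
  then show ?thesis
    unfolding ds_def base_value_family base_value_rev_family
    by (metis mult.assoc mult_right_cancel)
qed

theorem theorem1:
  fixes n a :: int
  assumes "n \<ge> 2" and "a > 0"
    and "n \<noteq> a" and "n \<noteq> 2 * a"
  shows "(\<exists>k. digit_solution 5 n k [a, a - 1, n - 1, n - a - 1, n - a]) \<longleftrightarrow> a dvd (n - a)"
    (is "(\<exists>k. digit_solution 5 n k ?ds) \<longleftrightarrow> _")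
proof
  assume "\<exists>k. digit_solution 5 n k ?ds"
  then obtain k where "k * base_value n ?ds = base_value n (rev ?ds)"
    unfolding digit_solution_def by blast
  then have "k * a = n - a"
    using digit_equation_family_iff[OF assms(1)] by blast
  then show "a dvd (n - a)"
    by (metis dvd_triv_right)
next
  assume dvd: "a dvd (n - a)"
  then obtain k where k: "n - a = a * k"
    by (rule dvdE)
  have "a dvd n"
    using dvd dvd_add[of a "n - a" a] by simp
  then have "a < n"
    using assms zdvd_imp_le[of a n] by simp
  then have "0 < k"
    using k assms(2) by (metis diff_gt_0_iff_gt zero_less_mult_pos)
  moreover have "k \<noteq> 1"
    using k assms(4) by auto
  ultimately have "1 < k"
    by simp
  have "k \<le> a * k"
    using \<open>0 < k\<close> assms(2) by simp
  then have "k < n"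
    using k assms(2) by linarith
  have "k * a = n - a"
    using k by (simp only: mult.commute)
  then have "k * base_value n ?ds = base_value n (rev ?ds)"
    using digit_equation_family_iff[OF assms(1)] by blast
  then have "digit_solution 5 n k ?ds"
    unfolding digit_solution_def
    using \<open>1 < k\<close> \<open>k < n\<close> \<open>a < n\<close> assms(1,2) by simp
  then show "\<exists>k. digit_solution 5 n k ?ds" ..
qed

end
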